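(* Consider a partially observed linear causal model with DAG $\mathcal G$ and $\Omega_{\epsilon_{\mathbf L}}=I$. For the parameters to be identifiable, it is necessary that every pair of distinct latent variables has at least one different parent or child (that is, no two distinct latent variables have both the same set of parents and the same set of children in $\mathcal G$).
   Context: Partially observed linear causal model: Let $\mathcal G$ be a DAG on $m+n$ variables $\mathbf V=\mathbf L\cup\mathbf X$, with $m$ latent variables $\mathbf L$ and $n$ observed variables $\mathbf X$. Each variable satisfies $V_i=\sum_{V_j\in \mathrm{Pa}_{\mathcal G}(V_i)} f_{j,i}V_j+\epsilon_{V_i}$ with independent Gaussian noise terms; in matrix form $\mathbf V=F^T\mathbf V+\epsilon_{\mathbf V}$, where $F=(f_{j,i})$ and $f_{j,i}\ne 0$ if and only if $V_j$ is a parent of $V_i$ in $\mathcal G$. $F$ has blocks $F_{\mathbf L\mathbf L},F_{\mathbf L\mathbf X},F_{\mathbf X\mathbf L},F_{\mathbf X\mathbf X}$, and $\Omega=\mathrm{diag}(\Omega_{\epsilon_{\mathbf L}},\Omega_{\epsilon_{\mathbf X}})$ is the diagonal covariance of $\epsilon_{\mathbf V}$. With $\theta=(F,\Omega)$, $\phi(\theta)=\Sigma_{\mathbf X}$ denotes the $\mathbf X$-block of $(I-F)^{-T}\Omega(I-F)^{-1}$. Identifiability. Let $\Theta$ be the set of all $\theta=(F,\Omega)$ for the given DAG (with $\Omega_{\epsilon_{\mathbf L}}=I$). Parameters are (generically) identifiable if, for Lebesgue-almost all $\theta\in\Theta$, no other $\theta'\in\Theta$ has $\phi(\theta')=\phi(\theta)$.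 Convention: parameters are still called identifiable if this holds up to group sign indeterminacy, i.e. $\phi(\theta')=\phi(\theta)$ implies that for some $m\times m$ diagonal sign matrix $S$ (entries $\pm1$): $F'_{\mathbf L\mathbf L}=SF_{\mathbf L\mathbf L}S$, $F'_{\mathbf L\mathbf X}=SF_{\mathbf L\mathbf X}$, $F'_{\mathbf X\mathbf L}=F_{\mathbf X\mathbf L}S$, $F'_{\mathbf X\mathbf X}=F_{\mathbf X\mathbf X}$, $\Omega'=\Omega$.
   Formalization: Pairs of latent variables that both have no parents and no children are excluded, since the claim fails for them: with no edges at all, the parameters are identifiable although all latents share empty parent and child sets. *)

theory Defs
  imports "HOL-Analysis.Analysis"
begin

text \<open>
  The latent variables are indexed by a finite type \<open>'l\<close>, the observed ones by a finite type
  \<open>'x\<close>; a vertex is \<open>Inl l\<close> (latent) or \<open>Inr x\<close> (observed). A directed graph is its edge relation,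
  where \<open>(u, v) \<in> G\<close> means \<open>u \<rightarrow> v\<close>; it is a DAG iff \<^term>\<open>acyclic G\<close>.
\<close>

definition parents :: "'v rel \<Rightarrow> 'v \<Rightarrow> 'v set" where
  "parents G v = {u. (u, v) \<in> G}"

definition children :: "'v rel \<Rightarrow> 'v \<Rightarrow> 'v set" where
  "children G v = {w. (v, w) \<in> G}"

type_synonym ('l, 'x) params =
  "(real ^ ('l + 'x) ^ ('l + 'x)) \<times> (real ^ ('l + 'x) ^ ('l + 'x))"

text \<open>
  A parameter is a pair \<open>(F, \<Omega>)\<close>. The entry \<open>F $ j $ i\<close> (row \<open>j\<close>, column \<open>i\<close>) is the coefficient
  of \<open>V j\<close> in the equation of \<open>V i\<close>, so that \<open>V = transpose F *v V + \<epsilon>\<close>.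
\<close>

definition param_space :: "('l::finite + 'x::finite) rel \<Rightarrow> ('l, 'x) params set" where
  "param_space G = {(F, \<Omega>).
     (\<forall>j i. F $ j $ i \<noteq> 0 \<longleftrightarrow> j \<in> parents G i) \<and>
     (\<forall>i j. i \<noteq> j \<longrightarrow> \<Omega> $ i $ j = 0) \<and>
     (\<forall>l. \<Omega> $ Inl l $ Inl l = 1) \<and>
     (\<forall>x. \<Omega> $ Inr x $ Inr x > 0)}"

definition block_LL :: "real ^ ('l::finite + 'x::finite) ^ ('l + 'x) \<Rightarrow> real ^ 'l ^ 'l" where
  "block_LL A = (\<chi> i j. A $ Inl i $ Inl j)"

definition block_LX :: "real ^ ('l::finite + 'x::finite) ^ ('l + 'x) \<Rightarrow> real ^ 'x ^ 'l" where
  "block_LX A = (\<chi> i j. A $ Inl i $ Inr j)"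

definition block_XL :: "real ^ ('l::finite + 'x::finite) ^ ('l + 'x) \<Rightarrow> real ^ 'l ^ 'x" where
  "block_XL A = (\<chi> i j. A $ Inr i $ Inl j)"

definition block_XX :: "real ^ ('l::finite + 'x::finite) ^ ('l + 'x) \<Rightarrow> real ^ 'x ^ 'x" where
  "block_XX A = (\<chi> i j. A $ Inr i $ Inr j)"

definition full_cov :: "('l::finite, 'x::finite) params \<Rightarrow> real ^ ('l + 'x) ^ ('l + 'x)" where
  "full_cov = (\<lambda>(F, \<Omega>). transpose (matrix_inv (mat 1 - F)) ** \<Omega> ** matrix_inv (mat 1 - F))"

definition observed_cov :: "('l::finite, 'x::finite) params \<Rightarrow> real ^ 'x ^ 'x" where
  "observed_cov \<theta> = block_XX (full_cov \<theta>)"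

text \<open>The inverse in \<^const>\<open>full_cov\<close> is a genuine one for every parameter of a DAG.\<close>

lemma invertible_one_minus_F:
  assumes "acyclic G" and "(F, \<Omega>) \<in> param_space G"
  shows "invertible (mat 1 - F)"
proof -
  have "x = 0" if x: "(mat 1 - F) *v x = 0" for x
  proof -
    have eq: "x = F *v x"
      using x by (simp add: matrix_vector_mult_diff_rdistrib)
    have "wf (G\<inverse>)"
      using assms(1) by (intro finite_acyclic_wf_converse) auto
    then have "x $ v = 0" for v
    proof (induction v rule: wf_induct_rule)
      case (less v)
      have "F $ v $ w * x $ w = 0" for w
        using less[of w] assms(2) by (auto simp: param_space_def parents_def)
      then have "(F *v x) $ v = 0"
        unfolding matrix_vector_mult_def by (auto intro!: sum.neutral)
      then show ?case
        using eq by simp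
    qed
    then show ?thesis
      by (simp add: vec_eq_iff)
  qed
  then show ?thesis
    by (simp add: invertible_left_inverse matrix_left_invertible_ker)
qed

definition sign_matrix :: "real ^ 'l::finite ^ 'l \<Rightarrow> bool" where
  "sign_matrix S \<longleftrightarrow>
     (\<forall>i j. i \<noteq> j \<longrightarrow> S $ i $ j = 0) \<and> (\<forall>i. S $ i $ i = 1 \<or> S $ i $ i = -1)"

definition sign_equivalent :: "('l::finite, 'x::finite) params \<Rightarrow> ('l, 'x) params \<Rightarrow> bool" where
  "sign_equivalent = (\<lambda>(F, \<Omega>) (F', \<Omega>'). \<exists>S. sign_matrix S \<and>
     block_LL F' = S ** block_LL F ** S \<and>
     block_LX F' = S ** block_LX F \<and>
     block_XL F' = block_XL F ** S \<and>
     block_XX F' = block_XX F \<and>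
     \<Omega>' = \<Omega>)"

text \<open>
  The free coordinates of a parameter are one real per edge and one noise variance per observed
  variable. ``Almost all'' refers to Lebesgue measure in these coordinates: as a set of pairs of
  matrices, \<^term>\<open>param_space G\<close> lies in a lower-dimensional affine subspace.
\<close>

definition params_of_coords ::
  "('l::finite + 'x::finite) rel \<Rightarrow> (('l + 'x) \<times> ('l + 'x) + 'x \<Rightarrow> real) \<Rightarrow> ('l, 'x) params" where
  "params_of_coords G c =
     ((\<chi> j i. if (j, i) \<in> G then c (Inl (j, i)) else 0),
      (\<chi> i j. if i = j then (case i of Inl l \<Rightarrow> 1 | Inr x \<Rightarrow> c (Inr x)) else 0))"

definition almost_all_params ::
  "('l::finite + 'x::finite) rel \<Rightarrow> (('l, 'x) params \<Rightarrow> bool) \<Rightarrow> bool" where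
  "almost_all_params G P \<longleftrightarrow>
     (AE c in Pi\<^sub>M (G <+> (UNIV :: 'x set)) (\<lambda>_. lborel).
        params_of_coords G c \<in> param_space G \<longrightarrow> P (params_of_coords G c))"

lemma bij_betw_params_of_coords:
  "bij_betw (params_of_coords G)
     {c \<in> space (Pi\<^sub>M (G <+> UNIV) (\<lambda>_. lborel)). (\<forall>e\<in>G. c (Inl e) \<noteq> 0) \<and> (\<forall>x. c (Inr x) > 0)}
     (param_space (G :: ('l::finite + 'x::finite) rel))"
  (is "bij_betw _ ?C _")
proof (rule bij_betw_imageI)
  show "inj_on (params_of_coords G) ?C"
  proof (rule inj_onI)
    fix c d
    assume c: "c \<in> ?C" and d: "d \<in> ?C" and eq: "params_of_coords G c = params_of_coords G d"
    have 1: "c (Inl (j, i)) = d (Inl (j, i))" if "(j, i) \<in> G" for j i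
      using arg_cong[OF eq, of "\<lambda>\<theta>. fst \<theta> $ j $ i"] that by (simp add: params_of_coords_def)
    have 2: "c (Inr x) = d (Inr x)" for x
      using arg_cong[OF eq, of "\<lambda>\<theta>. snd \<theta> $ Inr x $ Inr x"] by (simp add: params_of_coords_def)
    have "c \<in> (G <+> UNIV) \<rightarrow>\<^sub>E UNIV" "d \<in> (G <+> UNIV) \<rightarrow>\<^sub>E UNIV"
      using c d by (auto simp: space_PiM)
    then show "c = d"
      by (rule PiE_ext) (auto simp: 1 2)
  qed
next
  show "params_of_coords G ` ?C = param_space G"
  proof (intro equalityI subsetI)
    fix \<theta> assume "\<theta> \<in> params_of_coords G ` ?C"
    then show "\<theta> \<in> param_space G"
      by (auto simp: params_of_coords_def param_space_def parents_def split: if_splits)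
  next
    fix \<theta> assume th: "\<theta> \<in> param_space G"
    obtain F W where FW: "\<theta> = (F, W)" by (cases \<theta>)
    define c where "c = restrict (case_sum (\<lambda>(j, i). F $ j $ i) (\<lambda>x. W $ Inr x $ Inr x)) (G <+> UNIV)"
    have "c \<in> ?C"
      using th by (auto simp: FW c_def space_PiM param_space_def parents_def)
    moreover have "\<theta> = params_of_coords G c"
      using th by (auto simp: FW c_def params_of_coords_def param_space_def parents_def vec_eq_iff
          split: sum.splits)
    ultimately show "\<theta> \<in> params_of_coords G ` ?C"
      by blast
  qed
qed

definition generically_identifiable :: "('l::finite + 'x::finite) rel \<Rightarrow> bool" where
  "generically_identifiable G \<longleftrightarrow>
     almost_all_params G (\<lambda>\<theta>. \<forall>\<theta>'\<in>param_space G.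
       observed_cov \<theta>' = observed_cov \<theta> \<longrightarrow> sign_equivalent \<theta> \<theta>')"

text \<open>
  Isolated latent variables carry no parameters, because their noise variance is fixed to 1. A graph
  without edges is therefore identifiable although all latent variables have the same (empty) sets
  of parents and children.
\<close>

lemma generically_identifiable_empty:
  "generically_identifiable ({} :: ('l::finite + 'x::finite) rel)"
  (is "generically_identifiable ?G")
proof -
  have inv_1: "matrix_inv (mat 1 :: real ^ ('l + 'x) ^ ('l + 'x)) = mat 1"
    unfolding matrix_inv_def by (rule some_equality) simp_all
  have F: "fst \<theta> = 0" if "\<theta> \<in> param_space ?G" for \<theta>
    using that by (auto simp: param_space_def parents_def vec_eq_iff)
  have cov: "observed_cov \<theta> = block_XX (snd \<theta>)" if "\<theta> \<in> param_space ?G" for \<theta>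
    using F[OF that] by (cases \<theta>) (simp add: observed_cov_def full_cov_def inv_1 transpose_mat)
  have "sign_equivalent \<theta> \<theta>'"
    if t: "\<theta> \<in> param_space ?G" and t': "\<theta>' \<in> param_space ?G"
      and eq: "observed_cov \<theta>' = observed_cov \<theta>" for \<theta> \<theta>'
  proof -
    have x: "snd \<theta>' $ Inr x $ Inr x = snd \<theta> $ Inr x $ Inr x" for x
      using eq unfolding cov[OF t] cov[OF t'] by (auto simp: block_XX_def vec_eq_iff)
    have "snd \<theta>' $ i $ j = snd \<theta> $ i $ j" for i j
      using t t' x by (cases "i = j"; cases i) (auto simp: param_space_def)
    then have "snd \<theta>' = snd \<theta>"
      by (simp add: vec_eq_iff)
    then show ?thesis
      using F[OF t] F[OF t']
      by (cases \<theta>; cases \<theta>')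
        (auto simp: sign_equivalent_def sign_matrix_def block_LL_def block_LX_def block_XL_def
          block_XX_def vec_eq_iff matrix_matrix_mult_def mat_def intro!: exI[of _ "mat 1"])
  qed
  then show ?thesis
    unfolding generically_identifiable_def almost_all_params_def by auto
qed

end

theory Submission
  imports Defs "HOL-Computational_Algebra.Polynomial"
begin

text \<open>
  If two latent variables have the same parents and the same children, then conjugating \<open>F\<close> by a
  reflection \<open>Q\<close> of the plane spanned by their coordinates preserves the observed covariance, since
  \<open>\<Omega>\<close> is the identity on that plane and \<open>Q\<close> fixes the observed coordinates. For all but finitely
  many \<open>Q\<close> it also preserves the support of \<open>F\<close> and changes the absolute value of some coefficient,
  which no change of signs does. So every parameter violates identifiability, and the parameter
  space is not a null set.
\<close>

section \<open>Reflections of a coordinate plane\<close>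

text \<open>On the coordinates \<open>a\<close>, \<open>b\<close> this is the block with rows
  \<open>(c, s)\<close> and \<open>(s, -c)\<close>. Taking a reflection instead of a rotation makes
  it symmetric and, for \<open>c\<^sup>2 + s\<^sup>2 = 1\<close>, its own inverse, so that
  conjugation reads \<open>Q ** F ** Q\<close>.\<close>

definition plane_reflection :: "'v \<Rightarrow> 'v \<Rightarrow> real \<Rightarrow> real \<Rightarrow> real ^ 'v::finite ^ 'v" where
  "plane_reflection a b c s = (\<chi> i j.
     if i = a \<and> j = a then c
     else if i = b \<and> j = b then - c
     else if i = a \<and> j = b \<or> i = b \<and> j = a then s
     else if i = j then 1 else 0)"

lemma matrix_mult_plane_reflection:
  fixes A :: "real ^ 'v::finite ^ 'w::finite"
  assumes "a \<noteq> b"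
  shows "(A ** plane_reflection a b c s) $ i $ j =
    (if j = a then c * A $ i $ a + s * A $ i $ b
     else if j = b then s * A $ i $ a - c * A $ i $ b else A $ i $ j)"
proof -
  let ?f = "\<lambda>k. A $ i $ k * plane_reflection a b c s $ k $ j"
  have "(A ** plane_reflection a b c s) $ i $ j = sum ?f UNIV"
    by (simp add: matrix_matrix_mult_def)
  also have "\<dots> = sum ?f (if j = a \<or> j = b then {a, b} else {j})"
    by (rule sum.mono_neutral_right) (auto simp: plane_reflection_def)
  finally show ?thesis
    using assms by (auto simp: plane_reflection_def)
qed

lemma transpose_plane_reflection [simp]:
  "transpose (plane_reflection a b c s) = plane_reflection a b c s"
proof -
  have "transpose (plane_reflection a b c s) $ i $ j = plane_reflection a b c s $ i $ j" for i j
    by (cases "i = a"; cases "j = a"; cases "i = b"; cases "j = b")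
      (simp_all add: transpose_def plane_reflection_def)
  then show ?thesis
    by (simp add: vec_eq_iff)
qed

lemma plane_reflection_matrix_mult:
  fixes A :: "real ^ 'w::finite ^ 'v::finite"
  assumes "a \<noteq> b"
  shows "(plane_reflection a b c s ** A) $ i $ j =
    (if i = a then c * A $ a $ j + s * A $ b $ j
     else if i = b then s * A $ a $ j - c * A $ b $ j else A $ i $ j)"
proof -
  have "plane_reflection a b c s ** A = transpose (transpose A ** plane_reflection a b c s)"
    by (simp add: matrix_transpose_mul)
  then have "(plane_reflection a b c s ** A) $ i $ j =
      (transpose A ** plane_reflection a b c s) $ j $ i"
    by (simp add: transpose_def)
  then show ?thesis
    by (simp only: matrix_mult_plane_reflection[OF assms]) (simp add: transpose_def)
qed

lemma plane_reflection_involution: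
  assumes "a \<noteq> b" and "c\<^sup>2 + s\<^sup>2 = 1"
  shows "plane_reflection a b c s ** plane_reflection a b c s = mat 1"
proof -
  \<comment> \<open>The two orders of the sum are the diagonal entries at \<open>a\<close> and at
    \<open>b\<close>, as the entry formula produces them.\<close>
  have "c * c + s * s = 1" "s * s + c * c = 1"
    using assms(2) by (simp_all add: power2_eq_square)
  then have "(plane_reflection a b c s ** plane_reflection a b c s) $ i $ j = mat 1 $ i $ j" for i j
    unfolding matrix_mult_plane_reflection[OF assms(1)] using assms(1)
    by (simp add: plane_reflection_def mat_def)
  then show ?thesis
    by (simp add: vec_eq_iff)
qed

text \<open>On the plane \<open>D\<close> is a multiple of the identity, and off the plane the
  reflection is the identity.\<close>

lemma plane_reflection_commute:
  assumes "a \<noteq> b" and "D $ a $ a = D $ b $ b" and "\<And>i j. i \<noteq> j \<Longrightarrow> D $ i $ j = 0"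
  shows "D ** plane_reflection a b c s = plane_reflection a b c s ** D"
proof -
  have "(D ** plane_reflection a b c s) $ i $ j = (plane_reflection a b c s ** D) $ i $ j" for i j
    unfolding matrix_mult_plane_reflection[OF assms(1)] plane_reflection_matrix_mult[OF assms(1)]
    using assms by (cases "i = j") auto
  then show ?thesis
    by (simp add: vec_eq_iff)
qed

section \<open>Covariance under conjugation\<close>

lemma matrix_inv_works:
  fixes A :: "real ^ 'n::finite ^ 'n"
  assumes "invertible A"
  shows "A ** matrix_inv A = mat 1" "matrix_inv A ** A = mat 1"
proof -
  have "\<exists>B. A ** B = mat 1 \<and> B ** A = mat 1"
    using assms by (simp add: invertible_def)
  then have "A ** matrix_inv A = mat 1 \<and> matrix_inv A ** A = mat 1"
    unfolding matrix_inv_def by (rule someI_ex)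
  then show "A ** matrix_inv A = mat 1" "matrix_inv A ** A = mat 1"
    by simp_all
qed

lemma matrix_inv_eq:
  fixes A B :: "real ^ 'n::finite ^ 'n"
  assumes "A ** B = mat 1" and "B ** A = mat 1"
  shows "matrix_inv A = B"
proof -
  have "invertible A"
    using assms invertible_def by blast
  have "matrix_inv A = matrix_inv A ** (A ** B)"
    by (simp add: assms)
  also have "\<dots> = B"
    by (simp add: matrix_mul_assoc matrix_inv_works \<open>invertible A\<close>)
  finally show ?thesis .
qed

lemma matrix_conj_diff:
  fixes A B :: "real ^ 'n::finite ^ 'n"
  shows "Q ** (A - B) ** Q = Q ** A ** Q - Q ** B ** Q"
proof -
  have "Q ** (A - B) = Q ** A - Q ** B" and "(C - D) ** Q = C ** Q - D ** Q" for C D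
    by (simp_all add: matrix_matrix_mult_def vec_eq_iff algebra_simps sum_subtractf)
  then show ?thesis by simp
qed

text \<open>Since \<open>mat 1 - Q ** F ** Q = Q ** (mat 1 - F) ** Q\<close>, the inverse is
  conjugated as well. The two inner factors \<open>Q\<close> then meet around
  \<open>\<Omega>\<close> and cancel by \<open>comm\<close>.\<close>

lemma full_cov_conjugate:
  fixes Q :: "real ^ ('l::finite + 'x::finite) ^ ('l + 'x)"
  assumes inv: "invertible (mat 1 - F)"
    and QQ: "Q ** Q = mat 1" and Q: "transpose Q = Q" and comm: "\<Omega> ** Q = Q ** \<Omega>"
  shows "full_cov (Q ** F ** Q, \<Omega>) = Q ** full_cov (F, \<Omega>) ** Q"
proof -
  let ?N = "matrix_inv (mat 1 - F)"
  have cancel: "A ** Q ** Q = A" for A :: "real ^ ('l + 'x) ^ ('l + 'x)"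
    by (simp add: matrix_mul_assoc[symmetric] QQ)
  have eq: "mat 1 - Q ** F ** Q = Q ** (mat 1 - F) ** Q"
    by (simp add: matrix_conj_diff QQ)
  have "?N ** (mat 1 - F) = mat 1" "(mat 1 - F) ** ?N = mat 1"
    using matrix_inv_works[OF inv] by simp_all
  then have N: "A ** ?N ** (mat 1 - F) = A" "A ** (mat 1 - F) ** ?N = A"
    for A :: "real ^ ('l + 'x) ^ ('l + 'x)"
    by (simp_all add: matrix_mul_assoc[symmetric])
  have "matrix_inv (mat 1 - Q ** F ** Q) = Q ** ?N ** Q"
    unfolding eq by (rule matrix_inv_eq) (simp_all add: matrix_mul_assoc cancel N QQ)
  then show ?thesis
    by (simp add: full_cov_def matrix_transpose_mul Q matrix_mul_assoc cancel)
      (metis cancel comm matrix_mul_assoc)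
qed

section \<open>An invariant of sign equivalence\<close>

lemma sign_matrix_mult:
  assumes "sign_matrix S"
  shows "(S ** A) $ i $ j = S $ i $ i * A $ i $ j"
proof -
  have "(S ** A) $ i $ j = (\<Sum>k\<in>UNIV. S $ i $ k * A $ k $ j)"
    by (simp add: matrix_matrix_mult_def)
  also have "\<dots> = (\<Sum>k\<in>{i}. S $ i $ k * A $ k $ j)"
    using assms by (intro sum.mono_neutral_right) (auto simp: sign_matrix_def)
  finally show ?thesis by simp
qed

lemma mult_sign_matrix:
  assumes "sign_matrix S"
  shows "(A ** S) $ i $ j = A $ i $ j * S $ j $ j"
proof -
  have "(A ** S) $ i $ j = (\<Sum>k\<in>UNIV. A $ i $ k * S $ k $ j)"
    by (simp add: matrix_matrix_mult_def)
  also have "\<dots> = (\<Sum>k\<in>{j}. A $ i $ k * S $ k $ j)"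
    using assms by (intro sum.mono_neutral_right) (auto simp: sign_matrix_def)
  finally show ?thesis by simp
qed

text \<open>In every block an entry is multiplied only by diagonal entries of \<open>S\<close>,
  which are 1 or -1. One changed absolute value therefore refutes sign equivalence.\<close>

lemma sign_equivalent_abs_eq:
  assumes "sign_equivalent (F, \<Omega>) (F', \<Omega>')"
  shows "\<bar>F' $ u $ v\<bar> = \<bar>F $ u $ v\<bar>"
proof -
  obtain S where S: "sign_matrix S"
    and LL: "block_LL F' = S ** block_LL F ** S" and LX: "block_LX F' = S ** block_LX F"
    and XL: "block_XL F' = block_XL F ** S" and XX: "block_XX F' = block_XX F"
    using assms by (auto simp: sign_equivalent_def)
  have abs_S: "\<bar>S $ i $ i\<bar> = 1" for i
    using S by (metis sign_matrix_def abs_1 abs_minus_cancel)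
  note mult = sign_matrix_mult[OF S] mult_sign_matrix[OF S] abs_mult abs_S
  show ?thesis
  proof (cases u; cases v)
    fix i j assume "u = Inl i" "v = Inl j"
    then show ?thesis
      using arg_cong[OF LL, of "\<lambda>A. \<bar>A $ i $ j\<bar>"] by (simp add: mult) (simp add: block_LL_def)
  next
    fix i j assume "u = Inl i" "v = Inr j"
    then show ?thesis
      using arg_cong[OF LX, of "\<lambda>A. \<bar>A $ i $ j\<bar>"] by (simp add: mult) (simp add: block_LX_def)
  next
    fix i j assume "u = Inr i" "v = Inl j"
    then show ?thesis
      using arg_cong[OF XL, of "\<lambda>A. \<bar>A $ i $ j\<bar>"] by (simp add: mult) (simp add: block_XL_def)
  next
    fix i j assume "u = Inr i" "v = Inr j"
    then show ?thesis
      using arg_cong[OF XX, of "\<lambda>A. \<bar>A $ i $ j\<bar>"] by (simp add: block_XX_def)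
  qed
qed

section \<open>A generic point of the circle\<close>

text \<open>
  The rational parametrisation \<open>((1 - u\<^sup>2) / (1 + u\<^sup>2), 2 u / (1 + u\<^sup>2))\<close> of the circle turns each
  excluded equation into a nonzero polynomial in \<open>u\<close>.
\<close>

lemma exists_generic_circle_point:
  fixes P :: "(real \<times> real) set"
  assumes "finite P" and nz: "\<And>p q. (p, q) \<in> P \<Longrightarrow> p \<noteq> 0 \<and> q \<noteq> 0"
  obtains c s :: real where "c\<^sup>2 + s\<^sup>2 = 1"
    and "\<And>p q. (p, q) \<in> P \<Longrightarrow>
      c * p + s * q \<noteq> 0 \<and> s * p - c * q \<noteq> 0 \<and> \<bar>c * p + s * q\<bar> \<noteq> \<bar>p\<bar>"
proof -
  \<comment> \<open>Multiplied by \<open>1 + u\<^sup>2\<close>, the four equations are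
    \<open>c * p + s * q = 0\<close>, \<open>s * p - c * q = 0\<close>,
    \<open>c * p + s * q = p\<close> and \<open>c * p + s * q = - p\<close>.\<close>
  define bad where "bad = (\<lambda>(p, q). {u :: real. poly [:p, 2 * q, -p:] u = 0} \<union>
    {u. poly [:-q, 2 * p, q:] u = 0} \<union> {u. poly [:0, 2 * q, - 2 * p:] u = 0} \<union>
    {u. poly [:2 * p, 2 * q:] u = 0})"
  have "finite (bad x)" if "x \<in> P" for x
    using nz[of "fst x" "snd x"] that unfolding bad_def
    by (auto simp del: poly_pCons intro!: poly_roots_finite split: prod.splits)
  then have "finite (\<Union>x\<in>P. bad x)"
    using assms(1) by blast
  then obtain u where u: "u \<notin> (\<Union>x\<in>P. bad x)"
    using ex_new_if_finite[OF infinite_UNIV_char_0] by blast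
  define d where "d = 1 + u\<^sup>2"
  have d: "d > 0"
    unfolding d_def by (intro add_pos_nonneg) auto
  define c where "c = (1 - u\<^sup>2) / d"
  define s where "s = 2 * u / d"
  show thesis
  proof
    have "(1 - u\<^sup>2)\<^sup>2 + (2 * u)\<^sup>2 = d\<^sup>2"
      by (simp add: d_def power2_eq_square algebra_simps)
    then show "c\<^sup>2 + s\<^sup>2 = 1"
      using d by (simp add: c_def s_def power_divide add_divide_distrib[symmetric])
  next
    fix p q assume "(p, q) \<in> P"
    then have "u \<notin> bad (p, q)"
      using u by blast
    then have ne: "(1 - u\<^sup>2) * p + 2 * u * q \<noteq> 0" "2 * u * p - (1 - u\<^sup>2) * q \<noteq> 0"
      "(1 - u\<^sup>2) * p + 2 * u * q \<noteq> d * p" "(1 - u\<^sup>2) * p + 2 * u * q \<noteq> - (d * p)"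
      by (auto simp: bad_def d_def power2_eq_square algebra_simps)
    have "d * (c * p + s * q) = (1 - u\<^sup>2) * p + 2 * u * q"
      "d * (s * p - c * q) = 2 * u * p - (1 - u\<^sup>2) * q"
      using d by (simp_all add: c_def s_def field_simps)
    \<comment> \<open>Both sides carry the factor \<open>d\<close>, which is cancelled at the
      end.\<close>
    then have "d * (c * p + s * q) \<noteq> d * 0" "d * (s * p - c * q) \<noteq> d * 0"
      "d * (c * p + s * q) \<noteq> d * p" "d * (c * p + s * q) \<noteq> d * (- p)"
      using ne by simp_all
    then show "c * p + s * q \<noteq> 0 \<and> s * p - c * q \<noteq> 0 \<and> \<bar>c * p + s * q\<bar> \<noteq> \<bar>p\<bar>"
      using d by (auto simp: abs_eq_iff)
  qed
qed

section \<open>Twin latent variables\<close>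

text \<open>An edge between the two would, by equality of the parent sets, make its source a parent
  of itself.\<close>

lemma acyclic_twins_not_adjacent:
  assumes "acyclic G" and "parents G a = parents G b"
  shows "(a, a) \<notin> G" "(a, b) \<notin> G" "(b, a) \<notin> G" "(b, b) \<notin> G"
proof -
  show loop: "(a, a) \<notin> G" "(b, b) \<notin> G"
    using assms(1) by (auto simp: acyclic_def)
  show "(a, b) \<notin> G" "(b, a) \<notin> G"
    using loop assms(2) by (auto simp: parents_def)
qed

text \<open>The assumption \<open>ne\<close> supplies an edge whose coefficient changes in absolute
  value; if both twins were isolated, the reflection would leave \<open>F\<close> as it is.\<close>

lemma twin_latents_not_sign_equivalent:
  fixes G :: "('l::finite + 'x::finite) rel" and a b :: 'l
  assumes acyclic: "acyclic G" and "a \<noteq> b"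
    and par: "parents G (Inl a) = parents G (Inl b)"
    and chl: "children G (Inl a) = children G (Inl b)"
    and ne: "parents G (Inl a) \<union> children G (Inl a) \<noteq> {}"
    and \<theta>: "\<theta> \<in> param_space G"
  obtains \<theta>' where "\<theta>' \<in> param_space G" "observed_cov \<theta>' = observed_cov \<theta>"
    "\<not> sign_equivalent \<theta> \<theta>'"
proof -
  obtain F \<Omega> where FO: "\<theta> = (F, \<Omega>)"
    by (cases \<theta>)
  define \<alpha> where "\<alpha> = (Inl a :: 'l + 'x)"
  define \<beta> where "\<beta> = (Inl b :: 'l + 'x)"
  have ab: "\<alpha> \<noteq> \<beta>"
    using \<open>a \<noteq> b\<close> by (simp add: \<alpha>_def \<beta>_def)
  have supp: "F $ i $ j \<noteq> 0 \<longleftrightarrow> (i, j) \<in> G" for i j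
    using \<theta> by (auto simp: FO param_space_def parents_def)
  have par': "(w, \<beta>) \<in> G \<longleftrightarrow> (w, \<alpha>) \<in> G" and chl': "(\<beta>, w) \<in> G \<longleftrightarrow> (\<alpha>, w) \<in> G" for w
    using par chl by (auto simp: \<alpha>_def \<beta>_def parents_def children_def)
  have nadj: "(\<alpha>, \<alpha>) \<notin> G" "(\<alpha>, \<beta>) \<notin> G" "(\<beta>, \<alpha>) \<notin> G" "(\<beta>, \<beta>) \<notin> G"
    using acyclic_twins_not_adjacent[OF acyclic par] by (simp_all add: \<alpha>_def \<beta>_def)
  have zero: "F $ i $ j = 0 \<longleftrightarrow> (i, j) \<notin> G" for i j
    using supp by blast
  \<comment> \<open>One pair of twin coefficients for each common child and each common parent. The
    reflection sends \<open>(p, q)\<close> to \<open>(c * p + s * q, s * p - c * q)\<close>.\<close>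
  define P where "P = (\<lambda>w. (F $ \<alpha> $ w, F $ \<beta> $ w)) ` children G \<alpha> \<union>
    (\<lambda>w. (F $ w $ \<alpha>, F $ w $ \<beta>)) ` parents G \<alpha>"
  have "finite P"
    by (simp add: P_def)
  moreover have "p \<noteq> 0 \<and> q \<noteq> 0" if "(p, q) \<in> P" for p q
    using that by (auto simp: P_def zero parents_def children_def par' chl')
  ultimately obtain c s where cs: "c\<^sup>2 + s\<^sup>2 = 1"
    and generic: "\<And>p q. (p, q) \<in> P \<Longrightarrow>
      c * p + s * q \<noteq> 0 \<and> s * p - c * q \<noteq> 0 \<and> \<bar>c * p + s * q\<bar> \<noteq> \<bar>p\<bar>"
    using exists_generic_circle_point by blast
  have out: "c * F $ \<alpha> $ w + s * F $ \<beta> $ w \<noteq> 0 \<and> s * F $ \<alpha> $ w - c * F $ \<beta> $ w \<noteq> 0 \<and>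
      \<bar>c * F $ \<alpha> $ w + s * F $ \<beta> $ w\<bar> \<noteq> \<bar>F $ \<alpha> $ w\<bar>" if "(\<alpha>, w) \<in> G" for w
    using that by (intro generic) (auto simp: P_def children_def)
  have inc: "c * F $ w $ \<alpha> + s * F $ w $ \<beta> \<noteq> 0 \<and> s * F $ w $ \<alpha> - c * F $ w $ \<beta> \<noteq> 0 \<and>
      \<bar>c * F $ w $ \<alpha> + s * F $ w $ \<beta>\<bar> \<noteq> \<bar>F $ w $ \<alpha>\<bar>" if "(w, \<alpha>) \<in> G" for w
    using that by (intro generic) (auto simp: P_def parents_def)
  define Q where "Q = plane_reflection \<alpha> \<beta> c s"
  define F' where "F' = Q ** F ** Q"
  note entries = matrix_mult_plane_reflection[OF ab] plane_reflection_matrix_mult[OF ab]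
  \<comment> \<open>The block of \<open>F\<close> between the twins is zero, so at most one of the
    two factors \<open>Q\<close> affects any given entry.\<close>
  have entry: "F' $ i $ j =
      (if i = \<alpha> then (if j = \<alpha> \<or> j = \<beta> then 0 else c * F $ \<alpha> $ j + s * F $ \<beta> $ j)
       else if i = \<beta> then (if j = \<alpha> \<or> j = \<beta> then 0 else s * F $ \<alpha> $ j - c * F $ \<beta> $ j)
       else if j = \<alpha> then c * F $ i $ \<alpha> + s * F $ i $ \<beta>
       else if j = \<beta> then s * F $ i $ \<alpha> - c * F $ i $ \<beta> else F $ i $ j)" for i j
    unfolding F'_def Q_def entries using ab by (simp add: nadj[folded zero])
  have "F' $ i $ j \<noteq> 0" if ij: "(i, j) \<in> G" for i j
  proof -
    consider "i = \<alpha> \<or> i = \<beta>" "j \<noteq> \<alpha>" "j \<noteq> \<beta>" | "j = \<alpha> \<or> j = \<beta>" "i \<noteq> \<alpha>" "i \<noteq> \<beta>"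
      | "i \<noteq> \<alpha>" "i \<noteq> \<beta>" "j \<noteq> \<alpha>" "j \<noteq> \<beta>"
      using ij nadj by blast
    then show ?thesis
    proof cases
      case 1
      then have "(\<alpha>, j) \<in> G"
        using ij chl' by blast
      then show ?thesis
        using 1 ab out[of j] by (auto simp: entry)
    next
      case 2
      then have "(i, \<alpha>) \<in> G"
        using ij par' by blast
      then show ?thesis
        using 2 ab inc[of i] by (auto simp: entry)
    next
      case 3
      then show ?thesis
        using ij by (simp add: entry supp)
    qed
  qed
  \<comment> \<open>A non-edge at one twin is a non-edge at the other, so both terms of the
    combination vanish.\<close>
  moreover have "F' $ i $ j = 0" if ij: "(i, j) \<notin> G" for i j
    using ij by (auto simp: entry iffD2[OF zero] par' chl')
  ultimately have supp': "F' $ i $ j \<noteq> 0 \<longleftrightarrow> (i, j) \<in> G" for i j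
    by blast
  show thesis
  proof
    show "(F', \<Omega>) \<in> param_space G"
      using \<theta> supp' by (auto simp: FO param_space_def parents_def)
    \<comment> \<open>Both latent noise variances are 1, so the diagonal entries agree on the
      plane.\<close>
    have "\<Omega> ** Q = Q ** \<Omega>"
      unfolding Q_def using \<theta>
      by (intro plane_reflection_commute ab) (auto simp: FO param_space_def \<alpha>_def \<beta>_def)
    moreover have "invertible (mat 1 - F)"
      using invertible_one_minus_F[OF acyclic] \<theta> by (simp add: FO)
    moreover have "Q ** Q = mat 1"
      unfolding Q_def using ab cs by (rule plane_reflection_involution)
    ultimately have "full_cov (F', \<Omega>) = Q ** full_cov (F, \<Omega>) ** Q"
      unfolding F'_def by (intro full_cov_conjugate) (simp_all add: Q_def)
    \<comment> \<open>The plane is spanned by latent coordinates only.\<close>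
    moreover have "(Q ** A ** Q) $ Inr x $ Inr y = A $ Inr x $ Inr y" for A x y
      unfolding Q_def entries by (simp add: \<alpha>_def \<beta>_def)
    ultimately show "observed_cov (F', \<Omega>) = observed_cov \<theta>"
      by (simp add: FO observed_cov_def block_XX_def)
    have "\<exists>i j. \<bar>F' $ i $ j\<bar> \<noteq> \<bar>F $ i $ j\<bar>"
    proof -
      from ne consider w where "(\<alpha>, w) \<in> G" | w where "(w, \<alpha>) \<in> G"
        by (auto simp: \<alpha>_def parents_def children_def)
      then show ?thesis
      proof cases
        case 1
        moreover have "w \<noteq> \<alpha>" "w \<noteq> \<beta>"
          using 1 nadj by auto
        ultimately have "\<bar>F' $ \<alpha> $ w\<bar> \<noteq> \<bar>F $ \<alpha> $ w\<bar>"
          using out by (simp add: entry)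
        then show ?thesis by blast
      next
        case 2
        moreover have "w \<noteq> \<alpha>" "w \<noteq> \<beta>"
          using 2 nadj by auto
        ultimately have "\<bar>F' $ w $ \<alpha>\<bar> \<noteq> \<bar>F $ w $ \<alpha>\<bar>"
          using inc by (simp add: entry)
        then show ?thesis by blast
      qed
    qed
    then show "\<not> sign_equivalent \<theta> (F', \<Omega>)"
      unfolding FO using sign_equivalent_abs_eq by blast
  qed
qed

section \<open>From almost all parameters to one\<close>

text \<open>\<open>almost_all_params\<close> would hold vacuously if the coordinates of the
  parameter space formed a null set; they contain a box of measure 1.\<close>

lemma almost_all_params_imp_exists:
  fixes G :: "('l::finite + 'x::finite) rel"
  assumes "almost_all_params G P"
  shows "\<exists>\<theta>\<in>param_space G. P \<theta>"
proof (rule ccontr)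
  assume none: "\<not> (\<exists>\<theta>\<in>param_space G. P \<theta>)"
  interpret product_sigma_finite "\<lambda>_. lborel :: real measure"
    by standard
  let ?I = "G <+> (UNIV :: 'x set)"
  let ?M = "Pi\<^sub>M ?I (\<lambda>_. lborel :: real measure)"
  \<comment> \<open>The interval avoids 0, as edge coefficients must, is positive, as variances must
    be, and has length 1.\<close>
  let ?B = "Pi\<^sub>E ?I (\<lambda>_. {1..2 :: real})"
  have "params_of_coords G c \<in> param_space G" if "c \<in> ?B" for c
  proof -
    have 1: "c i > 0" if "i \<in> ?I" for i
      using PiE_mem[OF \<open>c \<in> ?B\<close> that] by simp
    have "c (Inl (i, j)) \<noteq> 0" if "(i, j) \<in> G" for i j
      using 1[OF InlI[OF that]] by simp
    moreover have "c (Inr x) > 0" for x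
      using 1[OF InrI[OF UNIV_I]] by simp
    ultimately show ?thesis
      by (auto simp: params_of_coords_def param_space_def parents_def)
  qed
  moreover have "AE c in ?M. params_of_coords G c \<notin> param_space G"
    using assms none unfolding almost_all_params_def by (auto elim!: eventually_mono)
  ultimately have "AE c in ?M. c \<notin> ?B"
    by (auto elim!: eventually_mono)
  moreover have "?B \<in> sets ?M"
    by (intro sets_PiM_I_finite) auto
  ultimately have "emeasure ?M ?B = 0"
    using AE_iff_measurable[of ?B ?M "\<lambda>c. c \<notin> ?B"] sets.sets_into_space[of ?B ?M] by auto
  moreover have "emeasure ?M ?B = 1"
    by (subst emeasure_PiM) auto
  ultimately show False by simp
qed

text \<open>The nonemptiness condition sets aside pairs of isolated latent variables, which
  \<open>generically_identifiable_empty\<close> shows to be compatible with identifiability.\<close>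

theorem corollary1:
  fixes G :: "('l::finite + 'x::finite) rel"
  assumes "acyclic G"
    and "generically_identifiable G"
  shows "\<forall>a b :: 'l. a \<noteq> b \<and>
      parents G (Inl a) \<union> children G (Inl a) \<union> parents G (Inl b) \<union> children G (Inl b) \<noteq> {} \<longrightarrow>
      parents G (Inl a) \<noteq> parents G (Inl b) \<or> children G (Inl a) \<noteq> children G (Inl b)"
proof (intro allI impI, rule ccontr)
  fix a b :: 'l
  assume *: "a \<noteq> b \<and>
      parents G (Inl a) \<union> children G (Inl a) \<union> parents G (Inl b) \<union> children G (Inl b) \<noteq> {}"
    and "\<not> (parents G (Inl a) \<noteq> parents G (Inl b) \<or> children G (Inl a) \<noteq> children G (Inl b))"
  then have twins: "parents G (Inl a) = parents G (Inl b)"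
      "children G (Inl a) = children G (Inl b)"
    by simp_all
  \<comment> \<open>A single identified parameter suffices, because twins give a counterexample at
    every parameter.\<close>
  obtain \<theta> where \<theta>: "\<theta> \<in> param_space G" and identified:
      "\<And>\<theta>'. \<theta>' \<in> param_space G \<Longrightarrow> observed_cov \<theta>' = observed_cov \<theta> \<Longrightarrow> sign_equivalent \<theta> \<theta>'"
    using almost_all_params_imp_exists assms(2) unfolding generically_identifiable_def by blast
  have "a \<noteq> b" "parents G (Inl a) \<union> children G (Inl a) \<noteq> {}"
    using * twins by auto
  then show False
    using twin_latents_not_sign_equivalent[OF assms(1) _ twins _ \<theta>] identified by blast
qed

end
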